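(* Let $a,b,c$ be nonnegative real numbers. The (unnormalized) state $A[a,b,c]\in M_3\otimes M_3$ is of PPT if and only if $$a\ge1,\qquad bc\ge1,$$ and it is separable if and only if all of the following conditions hold: $$a\ge1,\qquad bc\ge1,\qquad a+b-2\ge0,\qquad (b+a-2)(c+a-2)\ge(1-a)^2.$$
   Context: $M_n$ is the algebra of complex $n\times n$ matrices, with matrix units $e_{ij}$. $M_3\otimes M_3$ is identified with $9\times 9$ matrices using the lexicographically ordered basis $e_i\otimes e_j$ of $\mathbb C^3\otimes\mathbb C^3$. For nonnegative reals $a,b,c$, $A[a,b,c]$ is the $9\times9$ matrix with diagonal $(a,c,b,b,a,c,c,b,a)$, with entry $1$ at the positions $(i,j)$ for $i\ne j$ in $\{1,5,9\}$, and all other entries $0$. States are considered without normalization of the trace. A matrix is separable if it is a finite sum of matrices $zz^*$ with $z=x\otimes y$ a product vector in $\mathbb C^3\otimes\mathbb C^3$. For $A=\sum e_{ij}\otimes x_{ij}$ the partial transpose is $A^\Gamma=\sum e_{ij}\otimes x_{ji}$; $A$ is of PPT if both $A$ and $A^\Gamma$ are positive semi-definite. *)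

theory Defs
  imports "Jordan_Normal_Form.Conjugate" "Jordan_Normal_Form.Matrix"
begin

text \<open>
  Vectors and matrices are indexed from 0. The lexicographically ordered basis of
  the tensor product of \<open>\<complex>\<^sup>m\<close> and \<open>\<complex>\<^sup>n\<close> puts \<open>e\<^sub>i \<otimes> e\<^sub>k\<close>
  at position \<open>n * i + k\<close>, so position \<open>r\<close> belongs to the pair \<open>(r div n, r mod n)\<close>.
\<close>

definition tensor_vec :: "complex vec \<Rightarrow> complex vec \<Rightarrow> complex vec" where
  "tensor_vec x y = vec (dim_vec x * dim_vec y)
     (\<lambda>r. x $ (r div dim_vec y) * y $ (r mod dim_vec y))"

definition rank_one :: "complex vec \<Rightarrow> complex mat" where
  "rank_one z = mat (dim_vec z) (dim_vec z) (\<lambda>(r, s). z $ r * conjugate (z $ s))"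

text \<open>
  The order on \<open>complex\<close> is that of \<open>Complex_Order\<close>: \<open>0 \<le> w\<close> means that
  \<open>w\<close> is real and nonnegative. Hence the condition below forces \<open>A\<close> to be Hermitian.
\<close>

definition positive_semidefinite :: "complex mat \<Rightarrow> bool" where
  "positive_semidefinite A \<longleftrightarrow> square_mat A \<and>
     (\<forall>v \<in> carrier_vec (dim_row A). 0 \<le> (A *\<^sub>v v) \<bullet>c v)"

text \<open>The \<open>n \<times> n\<close> matrix \<open>x\<^sub>i\<^sub>j\<close> in \<open>A = \<Sum> e\<^sub>i\<^sub>j \<otimes> x\<^sub>i\<^sub>j\<close>.\<close>

definition mat_block :: "nat \<Rightarrow> complex mat \<Rightarrow> nat \<Rightarrow> nat \<Rightarrow> complex mat" where
  "mat_block n A i j = mat n n (\<lambda>(k, l). A $$ (n * i + k, n * j + l))"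

text \<open>The block of \<open>\<Sum> e\<^sub>i\<^sub>j \<otimes> x\<^sub>j\<^sub>i\<close> at \<open>(i, j)\<close> is \<open>x\<^sub>j\<^sub>i\<close>.\<close>

definition partial_transpose :: "nat \<Rightarrow> nat \<Rightarrow> complex mat \<Rightarrow> complex mat" where
  "partial_transpose m n A = mat (m * n) (m * n)
     (\<lambda>(r, s). mat_block n A (s div n) (r div n) $$ (r mod n, s mod n))"

definition is_ppt :: "nat \<Rightarrow> nat \<Rightarrow> complex mat \<Rightarrow> bool" where
  "is_ppt m n A \<longleftrightarrow> A \<in> carrier_mat (m * n) (m * n) \<and>
     positive_semidefinite A \<and> positive_semidefinite (partial_transpose m n A)"

text \<open>The finite sum is given by the list of its product vectors \<open>x \<otimes> y\<close>.\<close>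

definition separable :: "nat \<Rightarrow> nat \<Rightarrow> complex mat \<Rightarrow> bool" where
  "separable m n A \<longleftrightarrow> (\<exists>ps. set ps \<subseteq> carrier_vec m \<times> carrier_vec n \<and>
     A = foldr (+) (map (\<lambda>(x, y). rank_one (tensor_vec x y)) ps) (0\<^sub>m (m * n) (m * n)))"

definition A_mat :: "real \<Rightarrow> real \<Rightarrow> real \<Rightarrow> complex mat" where
  "A_mat a b c = mat 9 9 (\<lambda>(i, j).
     if i = j then complex_of_real ([a, c, b, b, a, c, c, b, a] ! i)
     else if i \<in> {0, 4, 8} \<and> j \<in> {0, 4, 8} then 1 else 0)"

end

theory Submission
  imports Defs
begin

text \<open>
  Necessity of the separability conditions: for every real \<open>s \<noteq> 0\<close> a generalized Choi witness, with
  weights proportional to \<open>((s - 1)\<^sup>2, s\<^sup>2, 1)\<close>, is nonnegative on product vectors. By the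
  Cauchy-Schwarz inequality this reduces to a cyclic cubic inequality in three nonnegative reals.
  Pairing with \<open>A[a,b,c]\<close> gives
  \<open>(a + b - 2) s\<^sup>2 - 2 (a - 1) s + (a + c - 2) \<ge> 0\<close> for all \<open>s\<close>, and the last two conditions say
  exactly this.

  Sufficiency: \<open>A[1,1,1]\<close> is separable, and so is \<open>A[2,b,1/b]\<close>, a sum of three \<open>2 \<otimes> 2\<close> pieces.
  All of them arise by averaging product vectors over a cyclic group of phases. For
  \<open>1 \<le> a \<le> 2\<close> the region is swept out by convex combinations of these with weights \<open>2 - a\<close> and
  \<open>a - 1\<close>, up to adding nonnegative diagonal matrices.
\<close>

section \<open>Real quadratic and cubic inequalities\<close>

text \<open>The value \<open>s = 0\<close> is excluded because the Choi witnesses are only available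
  for nonzero \<open>s\<close>. Continuity recovers it, and reversing the polynomial by
  \<open>s\<close> to \<open>1 / s\<close> turns the sign of the constant term into that of the
  leading one. The second claim is then the value at the vertex \<open>q / p\<close>.\<close>

lemma quadratic_nonneg_coeffs:
  fixes p q r :: real
  assumes "\<And>s. s \<noteq> 0 \<Longrightarrow> 0 \<le> p * s\<^sup>2 - 2 * q * s + r"
  shows "0 \<le> p" and "q\<^sup>2 \<le> p * r"
proof -
  have lim0: "0 \<le> w" if "\<And>s. s \<noteq> 0 \<Longrightarrow> 0 \<le> u * s\<^sup>2 - 2 * v * s + w" for u v w :: real
  proof (rule tendsto_lowerbound)
    have "((\<lambda>s. u * s\<^sup>2 - 2 * v * s + w) \<longlongrightarrow> u * 0\<^sup>2 - 2 * v * 0 + w) (at 0)"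
      by (intro tendsto_intros)
    then show "((\<lambda>s. u * s\<^sup>2 - 2 * v * s + w) \<longlongrightarrow> w) (at 0)"
      by simp
    show "\<forall>\<^sub>F s in at 0. 0 \<le> u * s\<^sup>2 - 2 * v * s + w"
      using that by (auto simp: eventually_at intro: exI[of _ 1])
  qed simp
  show p: "0 \<le> p"
  proof (rule lim0[of r q])
    fix s :: real
    assume "s \<noteq> 0"
    then have "0 \<le> (p * (1 / s)\<^sup>2 - 2 * q * (1 / s) + r) * s\<^sup>2"
      using assms[of "1 / s"] by (intro mult_nonneg_nonneg) auto
    also have "\<dots> = r * s\<^sup>2 - 2 * q * s + p"
      using \<open>s \<noteq> 0\<close> by (simp add: field_simps power2_eq_square)
    finally show "0 \<le> r * s\<^sup>2 - 2 * q * s + p" .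
  qed
  have r: "0 \<le> r"
    by (rule lim0[of p q]) (rule assms)
  show "q\<^sup>2 \<le> p * r"
  proof (cases "p = 0")
    case True
    have "q = 0"
    proof (rule ccontr)
      assume "q \<noteq> 0"
      \<comment> \<open>A linear function of nonzero slope takes negative values; this point makes
        it \<open>- r - 2\<close>.\<close>
      then have "0 \<le> - (2 * (r + 1)) + r"
        using assms[of "(r + 1) / q"] r True by simp
      then show False using r by simp
    qed
    then show ?thesis using True by simp
  next
    case False
    \<comment> \<open>For \<open>q = 0\<close> the vertex is the excluded point 0, so this case is
      separate.\<close>
    show ?thesis
    proof (cases "q = 0")
      case True
      then show ?thesis using p r by simp
    next
      case q: False
      have "0 \<le> (p * (q / p)\<^sup>2 - 2 * q * (q / p) + r) * p"
        using assms[of "q / p"] False q p by simp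
      also have "\<dots> = p * r - q\<^sup>2"
        using False by (simp add: field_simps power2_eq_square)
      finally show ?thesis by simp
    qed
  qed
qed

text \<open>
  The cubic vanishes at \<open>(1, 1, 1)\<close>, so after the shift by the minimum \<open>z\<close> the coefficients of
  \<open>z\<^sup>3\<close> and \<open>z\<^sup>2\<close> vanish; the part without \<open>z\<close> has the double zero \<open>u = s v\<close>.
\<close>

lemma cyclic_cubic_nonneg_if_min:
  fixes x y z s :: real
  assumes "0 \<le> z" "z \<le> x" "z \<le> y"
  defines "K \<equiv> s\<^sup>2 - s + 1" and "A \<equiv> 2 * s\<^sup>2 - 3 * s + 2"
  shows "K * (x * (A * y + s\<^sup>2 * z + x) * (A * z + s\<^sup>2 * x + y) +
      y * (A * x + s\<^sup>2 * y + z) * (A * z + s\<^sup>2 * x + y) +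
      z * (A * x + s\<^sup>2 * y + z) * (A * y + s\<^sup>2 * z + x))
    \<le> (A * x + s\<^sup>2 * y + z) * (A * y + s\<^sup>2 * z + x) * (A * z + s\<^sup>2 * x + y)"
proof -
  define u v where "u = x - z" and "v = y - z"
  have xy: "x = z + u" "y = z + v" and uv: "0 \<le> u" "0 \<le> v"
    using assms by (auto simp: u_def v_def)
  have "u * u - u * v + v * v = (u - v)\<^sup>2 + u * v"
    by (simp add: power2_eq_square algebra_simps)
  also have "0 \<le> \<dots>"
    using uv by simp
  finally have "0 \<le> (s - 1)\<^sup>2 * (K\<^sup>2 * z * (u * u - u * v + v * v) + (u - s * v)\<^sup>2 * (s\<^sup>2 * u + v))"
    using uv assms(1)
    by (intro mult_nonneg_nonneg[of "(s - 1)\<^sup>2"] add_nonneg_nonneg[of "K\<^sup>2 * z * _"]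
        mult_nonneg_nonneg[of "K\<^sup>2 * z"]) simp_all
  also have "\<dots> = (A * x + s\<^sup>2 * y + z) * (A * y + s\<^sup>2 * z + x) * (A * z + s\<^sup>2 * x + y) -
    K * (x * (A * y + s\<^sup>2 * z + x) * (A * z + s\<^sup>2 * x + y) +
      y * (A * x + s\<^sup>2 * y + z) * (A * z + s\<^sup>2 * x + y) +
      z * (A * x + s\<^sup>2 * y + z) * (A * y + s\<^sup>2 * z + x))"
    unfolding K_def A_def xy by (simp add: power2_eq_square algebra_simps)
  finally show ?thesis by simp
qed

lemma cyclic_cubic_nonneg:
  fixes x y z s :: real
  assumes "0 \<le> x" "0 \<le> y" "0 \<le> z"
  defines "K \<equiv> s\<^sup>2 - s + 1" and "A \<equiv> 2 * s\<^sup>2 - 3 * s + 2"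
  shows "K * (x * (A * y + s\<^sup>2 * z + x) * (A * z + s\<^sup>2 * x + y) +
      y * (A * x + s\<^sup>2 * y + z) * (A * z + s\<^sup>2 * x + y) +
      z * (A * x + s\<^sup>2 * y + z) * (A * y + s\<^sup>2 * z + x))
    \<le> (A * x + s\<^sup>2 * y + z) * (A * y + s\<^sup>2 * z + x) * (A * z + s\<^sup>2 * x + y)"
proof -
  \<comment> \<open>The inequality is invariant under cyclic shifts, so the minimum can be rotated
    into the last place.\<close>
  consider "z \<le> x" "z \<le> y" | "x \<le> y" "x \<le> z" | "y \<le> z" "y \<le> x"
    by linarith
  then show ?thesis
  proof cases
    case 1
    show ?thesis
      using cyclic_cubic_nonneg_if_min[OF assms(3) 1, of s] unfolding K_def A_def .
  next
    case 2
    show ?thesis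
      using cyclic_cubic_nonneg_if_min[OF assms(1) 2, of s] unfolding K_def A_def
      by (simp only: ac_simps)
  next
    case 3
    show ?thesis
      using cyclic_cubic_nonneg_if_min[OF assms(2) 3, of s] unfolding K_def A_def
      by (simp only: ac_simps)
  qed
qed

text \<open>Assumption \<open>le\<close> is \<open>K\<close> times the sum of
  \<open>x_i^2 / d_i\<close> being at most 1, cleared of denominators. The conclusion is then
  Cauchy-Schwarz with weights \<open>d_i\<close>; the proof uses Lagrange's identity in the same
  cleared form.\<close>

lemma weighted_Cauchy_Schwarz3:
  fixes x1 x2 x3 y1 y2 y3 d1 d2 d3 K :: real
  assumes d: "0 < d1" "0 < d2" "0 < d3"
    and K: "0 \<le> K"
    and le: "K * (x1\<^sup>2 * d2 * d3 + x2\<^sup>2 * d1 * d3 + x3\<^sup>2 * d1 * d2) \<le> d1 * d2 * d3"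
  shows "K * (x1 * y1 + x2 * y2 + x3 * y3)\<^sup>2 \<le> d1 * y1\<^sup>2 + d2 * y2\<^sup>2 + d3 * y3\<^sup>2"
proof -
  let ?S = "d1 * y1\<^sup>2 + d2 * y2\<^sup>2 + d3 * y3\<^sup>2"
  let ?T = "x1\<^sup>2 * d2 * d3 + x2\<^sup>2 * d1 * d3 + x3\<^sup>2 * d1 * d2"
  have "0 \<le> d3 * (d2 * x1 * y2 - d1 * x2 * y1)\<^sup>2 + d2 * (d3 * x1 * y3 - d1 * x3 * y1)\<^sup>2
      + d1 * (d3 * x2 * y3 - d2 * x3 * y2)\<^sup>2"
    using d by simp
  also have "\<dots> = ?T * ?S - d1 * d2 * d3 * (x1 * y1 + x2 * y2 + x3 * y3)\<^sup>2"
    by (simp add: power2_eq_square algebra_simps)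
  finally have "d1 * d2 * d3 * (x1 * y1 + x2 * y2 + x3 * y3)\<^sup>2 \<le> ?T * ?S"
    by simp
  then have "K * (d1 * d2 * d3 * (x1 * y1 + x2 * y2 + x3 * y3)\<^sup>2) \<le> K * (?T * ?S)"
    using K by (rule mult_left_mono)
  also have "\<dots> \<le> d1 * d2 * d3 * ?S"
    using mult_right_mono[OF le, of ?S] d by (simp add: mult.assoc)
  finally have "(d1 * d2 * d3) * (K * (x1 * y1 + x2 * y2 + x3 * y3)\<^sup>2) \<le> (d1 * d2 * d3) * ?S"
    by (simp add: ac_simps)
  then show ?thesis
    using d by simp
qed

text \<open>For fixed \<open>x\<close> the right side is a diagonal quadratic form in
  \<open>y\<close>, and the left side is a multiple of the square of a linear form. Cauchy-Schwarz
  leaves exactly the cyclic cubic in the squares of the \<open>x_i\<close>.\<close>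

lemma Choi_form_nonneg:
  fixes x1 x2 x3 y1 y2 y3 s :: real
  assumes "s \<noteq> 0"
  shows "(s\<^sup>2 - s + 1) * (x1 * y1 + x2 * y2 + x3 * y3)\<^sup>2
    \<le> (2 * s\<^sup>2 - 3 * s + 2) * ((x1 * y1)\<^sup>2 + (x2 * y2)\<^sup>2 + (x3 * y3)\<^sup>2)
      + s\<^sup>2 * ((x2 * y1)\<^sup>2 + (x3 * y2)\<^sup>2 + (x1 * y3)\<^sup>2)
      + ((x3 * y1)\<^sup>2 + (x1 * y2)\<^sup>2 + (x2 * y3)\<^sup>2)"
proof (cases "x1 = 0 \<and> x2 = 0 \<and> x3 = 0")
  case True
  then show ?thesis by simp
next
  case False
  define A where "A = 2 * s\<^sup>2 - 3 * s + 2"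
  have "A = 2 * (s - 3 / 4)\<^sup>2 + 7 / 8" "s\<^sup>2 - s + 1 = (s - 1 / 2)\<^sup>2 + 3 / 4"
    by (simp_all add: A_def power2_eq_square algebra_simps)
  then have A: "0 < A" and K: "0 \<le> s\<^sup>2 - s + 1"
    by (simp_all add: add_nonneg_pos)
  \<comment> \<open>Strict positivity of the weights is where \<open>s \<noteq> 0\<close> enters:
    only the middle term survives when \<open>u = w = 0\<close>.\<close>
  have D: "0 < A * u\<^sup>2 + s\<^sup>2 * v\<^sup>2 + w\<^sup>2" if "\<not> (u = 0 \<and> v = 0 \<and> w = 0)" for u v w
  proof -
    have "0 \<le> A * u\<^sup>2" "0 \<le> s\<^sup>2 * v\<^sup>2" "0 \<le> w\<^sup>2"
      using A by simp_all
    moreover have "A * u\<^sup>2 \<noteq> 0 \<or> s\<^sup>2 * v\<^sup>2 \<noteq> 0 \<or> w\<^sup>2 \<noteq> 0"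
      using that A assms by auto
    ultimately show ?thesis by linarith
  qed
  have "(s\<^sup>2 - s + 1) * (x1 * y1 + x2 * y2 + x3 * y3)\<^sup>2
      \<le> (A * x1\<^sup>2 + s\<^sup>2 * x2\<^sup>2 + x3\<^sup>2) * y1\<^sup>2 + (A * x2\<^sup>2 + s\<^sup>2 * x3\<^sup>2 + x1\<^sup>2) * y2\<^sup>2
        + (A * x3\<^sup>2 + s\<^sup>2 * x1\<^sup>2 + x2\<^sup>2) * y3\<^sup>2"
    using False cyclic_cubic_nonneg[of "x1\<^sup>2" "x2\<^sup>2" "x3\<^sup>2" s]
    by (intro weighted_Cauchy_Schwarz3 D K) (auto simp: A_def)
  also have "\<dots> = A * ((x1 * y1)\<^sup>2 + (x2 * y2)\<^sup>2 + (x3 * y3)\<^sup>2)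
      + s\<^sup>2 * ((x2 * y1)\<^sup>2 + (x3 * y2)\<^sup>2 + (x1 * y3)\<^sup>2)
      + ((x3 * y1)\<^sup>2 + (x1 * y2)\<^sup>2 + (x2 * y3)\<^sup>2)"
    by (simp add: power2_eq_square algebra_simps)
  finally show ?thesis by (simp add: A_def)
qed

section \<open>The cone of separable matrices and functionals on it\<close>

lemma rank_one_tensor_carrier:
  "x \<in> carrier_vec m \<Longrightarrow> y \<in> carrier_vec n \<Longrightarrow>
    rank_one (tensor_vec x y) \<in> carrier_mat (m * n) (m * n)"
  by (auto simp: rank_one_def tensor_vec_def)

lemma rank_one_tensor_index:
  assumes "x \<in> carrier_vec m" "y \<in> carrier_vec n" "r < m * n" "s < m * n"
  shows "rank_one (tensor_vec x y) $$ (r, s) =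
    x $ (r div n) * y $ (r mod n) * cnj (x $ (s div n) * y $ (s mod n))"
  using assms by (auto simp: rank_one_def tensor_vec_def)

lemma foldr_add_mat_carrier:
  assumes "\<And>x. x \<in> set xs \<Longrightarrow> f x \<in> carrier_mat n m"
  shows "foldr (+) (map f xs) (0\<^sub>m n m) \<in> carrier_mat n m"
  using assms by (induction xs) auto

lemma foldr_add_mat_index:
  assumes "\<And>x. x \<in> set xs \<Longrightarrow> f x \<in> carrier_mat n m" "r < n" "s < m"
  shows "foldr (+) (map f xs) (0\<^sub>m n m) $$ (r, s) = (\<Sum>x\<leftarrow>xs. f x $$ (r, s))"
  using assms
proof (induction xs)
  case (Cons x xs)
  then have "foldr (+) (map f xs) (0\<^sub>m n m) \<in> carrier_mat n m"
    by (intro foldr_add_mat_carrier) auto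
  then show ?case using Cons by auto
qed simp

lemma separable_add:
  assumes "separable m n A" "separable m n B"
  shows "separable m n (A + B)"
proof -
  let ?f = "\<lambda>(x, y). rank_one (tensor_vec x y)"
  let ?z = "0\<^sub>m (m * n) (m * n) :: complex mat"
  obtain ps qs where ps: "set ps \<subseteq> carrier_vec m \<times> carrier_vec n" "A = foldr (+) (map ?f ps) ?z"
    and qs: "set qs \<subseteq> carrier_vec m \<times> carrier_vec n" "B = foldr (+) (map ?f qs) ?z"
    using assms by (auto simp: separable_def)
  have car: "foldr (+) (map ?f us) ?z \<in> carrier_mat (m * n) (m * n)"
    if "set us \<subseteq> carrier_vec m \<times> carrier_vec n" for us
    using that by (intro foldr_add_mat_carrier) (auto intro: rank_one_tensor_carrier)
  have B: "B \<in> carrier_mat (m * n) (m * n)"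
    using qs car by simp
  \<comment> \<open>By associativity \<open>B\<close> can replace the start value of the fold, which
    is how \<open>foldr\<close> treats an appended list.\<close>
  have "foldr (+) (map ?f us) ?z + B = foldr (+) (map ?f us) B"
    if "set us \<subseteq> carrier_vec m \<times> carrier_vec n" for us
    using that
  proof (induction us)
    case (Cons u us)
    then have "?f u \<in> carrier_mat (m * n) (m * n)"
      by (auto intro: rank_one_tensor_carrier)
    then show ?case
      using Cons car[of us] B by (simp add: assoc_add_mat[of _ "m * n" "m * n"])
  qed (use B in simp)
  then have "A + B = foldr (+) (map ?f (ps @ qs)) ?z"
    using ps qs by simp
  then show ?thesis
    using ps(1) qs(1) unfolding separable_def by (intro exI[of _ "ps @ qs"]) auto
qed

text \<open>Additivity is enough, without homogeneity: the sum has no coefficients, as the vectors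
  absorb them.\<close>

lemma separable_functional_nonneg:
  fixes L :: "complex mat \<Rightarrow> real"
  assumes sep: "separable m n A"
    and zero: "L (0\<^sub>m (m * n) (m * n)) = 0"
    and add: "\<And>B C. B \<in> carrier_mat (m * n) (m * n) \<Longrightarrow> C \<in> carrier_mat (m * n) (m * n) \<Longrightarrow>
      L (B + C) = L B + L C"
    and nonneg: "\<And>x y. x \<in> carrier_vec m \<Longrightarrow> y \<in> carrier_vec n \<Longrightarrow>
      0 \<le> L (rank_one (tensor_vec x y))"
  shows "0 \<le> L A"
proof -
  let ?f = "\<lambda>(x, y). rank_one (tensor_vec x y)"
  let ?z = "0\<^sub>m (m * n) (m * n) :: complex mat"
  have "0 \<le> L (foldr (+) (map ?f ps) ?z)" if "set ps \<subseteq> carrier_vec m \<times> carrier_vec n" for ps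
    using that
  proof (induction ps)
    case (Cons p ps)
    then have "foldr (+) (map ?f ps) ?z \<in> carrier_mat (m * n) (m * n)"
      by (intro foldr_add_mat_carrier) (auto intro: rank_one_tensor_carrier)
    then show ?case
      using Cons nonneg by (auto simp: add rank_one_tensor_carrier)
  qed (simp add: zero)
  then show ?thesis
    using sep by (auto simp: separable_def)
qed

section \<open>Entanglement witnesses and necessity\<close>

text \<open>\<open>L\<close> pairs with a matrix of the same pattern as \<open>A_mat\<close>:
  weights \<alpha>, \<beta>, \<gamma> on the diagonal positions of \<open>a\<close>,
  \<open>b\<close>, \<open>c\<close>, and -\<kappa> where \<open>A_mat\<close> has ones off the
  diagonal. Completing the off-diagonal terms to a full square costs \<kappa> on the diagonal,
  whence \<alpha> + \<kappa> in \<open>form\<close>. The pairing has three terms of each diagonal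
  kind and six ones, which gives the factor 2.\<close>

lemma separable_A_mat_witness:
  fixes \<alpha> \<beta> \<gamma> \<kappa> :: real
  assumes sep: "separable 3 3 (A_mat a b c)"
    and form: "\<And>x1 x2 x3 y1 y2 y3 :: complex.
      \<kappa> * (cmod (x1 * y1 + x2 * y2 + x3 * y3))\<^sup>2
      \<le> (\<alpha> + \<kappa>) * ((cmod (x1 * y1))\<^sup>2 + (cmod (x2 * y2))\<^sup>2 + (cmod (x3 * y3))\<^sup>2)
        + \<beta> * ((cmod (x2 * y1))\<^sup>2 + (cmod (x3 * y2))\<^sup>2 + (cmod (x1 * y3))\<^sup>2)
        + \<gamma> * ((cmod (x3 * y1))\<^sup>2 + (cmod (x1 * y2))\<^sup>2 + (cmod (x2 * y3))\<^sup>2)"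
  shows "2 * \<kappa> \<le> \<alpha> * a + \<beta> * b + \<gamma> * c"
proof -
  define L where "L A = \<alpha> * Re (A $$ (0,0) + A $$ (4,4) + A $$ (8,8))
      + \<beta> * Re (A $$ (3,3) + A $$ (7,7) + A $$ (2,2))
      + \<gamma> * Re (A $$ (6,6) + A $$ (1,1) + A $$ (5,5))
      - \<kappa> * Re (A $$ (0,4) + A $$ (0,8) + A $$ (4,0) + A $$ (4,8) + A $$ (8,0) + A $$ (8,4))"
    for A :: "complex mat"
  have "0 \<le> L (A_mat a b c)"
    using sep
  proof (rule separable_functional_nonneg)
    fix x y :: "complex vec"
    define w where "w i k = x $ i * y $ k" for i k
    assume "x \<in> carrier_vec 3" "y \<in> carrier_vec 3"
    then have entry: "rank_one (tensor_vec x y) $$ (r, s) =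
        w (r div 3) (r mod 3) * cnj (w (s div 3) (s mod 3))" if "r < 9" "s < 9" for r s
      using that by (simp add: w_def rank_one_tensor_index)
    have "L (rank_one (tensor_vec x y)) =
      (\<alpha> + \<kappa>) * ((cmod (x $ 0 * y $ 0))\<^sup>2 + (cmod (x $ 1 * y $ 1))\<^sup>2 + (cmod (x $ 2 * y $ 2))\<^sup>2)
      + \<beta> * ((cmod (x $ 1 * y $ 0))\<^sup>2 + (cmod (x $ 2 * y $ 1))\<^sup>2 + (cmod (x $ 0 * y $ 2))\<^sup>2)
      + \<gamma> * ((cmod (x $ 2 * y $ 0))\<^sup>2 + (cmod (x $ 0 * y $ 1))\<^sup>2 + (cmod (x $ 1 * y $ 2))\<^sup>2)
      - \<kappa> * (cmod (x $ 0 * y $ 0 + x $ 1 * y $ 1 + x $ 2 * y $ 2))\<^sup>2"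
      unfolding L_def w_def[symmetric] cmod_power2
      by (simp add: entry numeral_2_eq_2 power2_eq_square algebra_simps)
    then show "0 \<le> L (rank_one (tensor_vec x y))"
      using form[of "x $ 0" "y $ 0" "x $ 1" "y $ 1" "x $ 2" "y $ 2"] by simp
  qed (auto simp: L_def algebra_simps)
  also have "L (A_mat a b c) = 3 * (\<alpha> * a + \<beta> * b + \<gamma> * c - 2 * \<kappa>)"
    by (simp add: L_def A_mat_def algebra_simps)
  finally show ?thesis by simp
qed

lemma separable_A_mat_necessary:
  assumes sep: "separable 3 3 (A_mat a b c)"
  shows "1 \<le> a" and "1 \<le> b * c" and "0 \<le> a + b - 2"
    and "(1 - a)\<^sup>2 \<le> (b + a - 2) * (c + a - 2)"
proof -
  have "2 * 1 \<le> 2 * a + 0 * b + 0 * c"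
    using sep
  proof (rule separable_A_mat_witness)
    fix x1 x2 x3 y1 y2 y3 :: complex
    have *: "(cmod (u + v + w))\<^sup>2 \<le> 3 * ((cmod u)\<^sup>2 + (cmod v)\<^sup>2 + (cmod w)\<^sup>2)" for u v w
    proof -
      have "0 \<le> (cmod (u - v))\<^sup>2 + (cmod (u - w))\<^sup>2 + (cmod (v - w))\<^sup>2"
        by simp
      also have "\<dots> = 3 * ((cmod u)\<^sup>2 + (cmod v)\<^sup>2 + (cmod w)\<^sup>2) - (cmod (u + v + w))\<^sup>2"
        unfolding cmod_power2 by (simp add: power2_eq_square algebra_simps)
      finally show ?thesis by simp
    qed
    show "1 * (cmod (x1 * y1 + x2 * y2 + x3 * y3))\<^sup>2
      \<le> (2 + 1) * ((cmod (x1 * y1))\<^sup>2 + (cmod (x2 * y2))\<^sup>2 + (cmod (x3 * y3))\<^sup>2)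
        + 0 * ((cmod (x2 * y1))\<^sup>2 + (cmod (x3 * y2))\<^sup>2 + (cmod (x1 * y3))\<^sup>2)
        + 0 * ((cmod (x3 * y1))\<^sup>2 + (cmod (x1 * y2))\<^sup>2 + (cmod (x2 * y3))\<^sup>2)"
      using *[of "x1 * y1" "x2 * y2" "x3 * y3"] by simp
  qed
  then show "1 \<le> a" by simp

  \<comment> \<open>This witness has a positive semidefinite partial transpose: with
    \<open>y\<close> conjugated, its form is a sum of three squares. The resulting quadratic in
    \<open>s\<close> has discriminant condition \<open>1 \<le> b * c\<close>.\<close>
  have "0 \<le> b * s\<^sup>2 - 2 * 1 * s + c" for s
  proof -
    have "2 * s \<le> 0 * a + s\<^sup>2 * b + 1 * c"
      using sep
    proof (rule separable_A_mat_witness)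
      fix x1 x2 x3 y1 y2 y3 :: complex
      have "0 \<le> (cmod (s * x2 * cnj y1 - x1 * cnj y2))\<^sup>2 + (cmod (s * x3 * cnj y2 - x2 * cnj y3))\<^sup>2
          + (cmod (s * x1 * cnj y3 - x3 * cnj y1))\<^sup>2"
        by simp
      also have "\<dots> = s * ((cmod (x1 * y1))\<^sup>2 + (cmod (x2 * y2))\<^sup>2 + (cmod (x3 * y3))\<^sup>2)
          + s\<^sup>2 * ((cmod (x2 * y1))\<^sup>2 + (cmod (x3 * y2))\<^sup>2 + (cmod (x1 * y3))\<^sup>2)
          + ((cmod (x3 * y1))\<^sup>2 + (cmod (x1 * y2))\<^sup>2 + (cmod (x2 * y3))\<^sup>2)
          - s * (cmod (x1 * y1 + x2 * y2 + x3 * y3))\<^sup>2"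
        unfolding cmod_power2 by (simp add: power2_eq_square algebra_simps)
      finally show "s * (cmod (x1 * y1 + x2 * y2 + x3 * y3))\<^sup>2
        \<le> (0 + s) * ((cmod (x1 * y1))\<^sup>2 + (cmod (x2 * y2))\<^sup>2 + (cmod (x3 * y3))\<^sup>2)
          + s\<^sup>2 * ((cmod (x2 * y1))\<^sup>2 + (cmod (x3 * y2))\<^sup>2 + (cmod (x1 * y3))\<^sup>2)
          + 1 * ((cmod (x3 * y1))\<^sup>2 + (cmod (x1 * y2))\<^sup>2 + (cmod (x2 * y3))\<^sup>2)"
        by simp
    qed
    then show ?thesis by (simp add: mult.commute)
  qed
  from quadratic_nonneg_coeffs(2)[OF this] show "1 \<le> b * c"
    by simp

  \<comment> \<open>The generalized Choi weights. Here \<kappa> is half of \<alpha> + \<beta> +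
    \<gamma>, so the witness vanishes on \<open>A[1,1,1]\<close>.\<close>
  have "0 \<le> (b + a - 2) * s\<^sup>2 - 2 * (a - 1) * s + (c + a - 2)" if "s \<noteq> 0" for s
  proof -
    have "2 * (s\<^sup>2 - s + 1) \<le> (s - 1)\<^sup>2 * a + s\<^sup>2 * b + 1 * c"
      using sep
    proof (rule separable_A_mat_witness)
      fix x1 x2 x3 y1 y2 y3 :: complex
      \<comment> \<open>The right side depends only on moduli, so the triangle inequality reduces
        the claim to real numbers.\<close>
      have "cmod (x1 * y1 + x2 * y2 + x3 * y3)
          \<le> cmod x1 * cmod y1 + cmod x2 * cmod y2 + cmod x3 * cmod y3"
        by (metis norm_mult norm_triangle_le norm_triangle_mono order_refl)
      moreover have "s\<^sup>2 - s + 1 = (s - 1 / 2)\<^sup>2 + 3 / 4"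
        by (simp add: power2_eq_square algebra_simps)
      ultimately have "(s\<^sup>2 - s + 1) * (cmod (x1 * y1 + x2 * y2 + x3 * y3))\<^sup>2
          \<le> (s\<^sup>2 - s + 1) * (cmod x1 * cmod y1 + cmod x2 * cmod y2 + cmod x3 * cmod y3)\<^sup>2"
        by (intro mult_left_mono power_mono) auto
      also note Choi_form_nonneg[OF that]
      also have "2 * s\<^sup>2 - 3 * s + 2 = (s - 1)\<^sup>2 + (s\<^sup>2 - s + 1)"
        by (simp add: power2_eq_square algebra_simps)
      finally show "(s\<^sup>2 - s + 1) * (cmod (x1 * y1 + x2 * y2 + x3 * y3))\<^sup>2
        \<le> ((s - 1)\<^sup>2 + (s\<^sup>2 - s + 1))
            * ((cmod (x1 * y1))\<^sup>2 + (cmod (x2 * y2))\<^sup>2 + (cmod (x3 * y3))\<^sup>2)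
          + s\<^sup>2 * ((cmod (x2 * y1))\<^sup>2 + (cmod (x3 * y2))\<^sup>2 + (cmod (x1 * y3))\<^sup>2)
          + 1 * ((cmod (x3 * y1))\<^sup>2 + (cmod (x1 * y2))\<^sup>2 + (cmod (x2 * y3))\<^sup>2)"
        by (simp add: norm_mult)
    qed
    then show ?thesis
      by (simp add: power2_eq_square algebra_simps)
  qed
  from quadratic_nonneg_coeffs[OF this]
  show "0 \<le> a + b - 2" "(1 - a)\<^sup>2 \<le> (b + a - 2) * (c + a - 2)"
    by (simp_all add: power2_commute)
qed

section \<open>Averaging product vectors over seventh roots of unity\<close>

lemma sum_cis_root_of_unity:
  fixes m :: int and n :: nat
  assumes "\<bar>m\<bar> < int n"
  shows "(\<Sum>k<n. cis (2 * pi * real k * m / n)) = (if m = 0 then of_nat n else 0)"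
proof (cases "m = 0")
  case False
  define w where "w = cis (2 * pi * m / n)"
  have n: "0 < n" using assms by auto
  have "w \<noteq> 1"
  proof
    assume "w = 1"
    then have "cos (2 * pi * m / n) = 1"
      by (simp add: w_def complex_eq_iff)
    then obtain j :: int where "2 * pi * m / n = j * 2 * pi"
      by (auto simp: cos_one_2pi_int)
    then have "real_of_int m = real_of_int (j * int n)"
      using n by (simp add: field_simps)
    then have "m = j * int n"
      by linarith
    then show False
      using assms False by (simp add: abs_mult)
  qed
  moreover have "w ^ n = 1"
    using n by (simp add: w_def DeMoivre mult.commute[of "real n"])
  ultimately have "(\<Sum>k<n. w ^ k) = 0"
    by (simp add: geometric_sum)
  moreover have "w ^ k = cis (2 * pi * real k * m / n)" for k
    by (simp add: w_def DeMoivre mult_ac)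
  ultimately show ?thesis using False by simp
qed simp

lemma less_9_iff: "(r::nat) < 9 \<longleftrightarrow> r \<in> {0, 1, 2, 3, 4, 5, 6, 7, 8}"
  by auto

text \<open>
  The pairwise sums of \<open>0, 1, 3\<close> are distinct, and differences of such sums are smaller than
  \<open>7\<close> in absolute value, so seventh roots of unity already do the work of the full torus.
\<close>

definition Sidon_exponent :: "nat \<Rightarrow> int" where
  "Sidon_exponent i = [0, 1, 3] ! i"

definition phase :: "nat \<Rightarrow> nat \<Rightarrow> complex" where
  "phase k i = cis (2 * pi * real k * Sidon_exponent i / 7)"

text \<open>The total exponent compares the sum for \<open>i, l\<close> with the sum for
  \<open>k, j\<close>. It vanishes only if the two pairs agree up to order.\<close>

lemma sum_phase:
  assumes "i < 3" "j < 3" "k < 3" "l < 3"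
  shows "(\<Sum>t<7. phase t i * cnj (phase t k) * cnj (phase t j * cnj (phase t l))) =
    (if i = k \<and> j = l \<or> i = j \<and> k = l then 7 else 0)"
proof -
  define m where "m = Sidon_exponent i - Sidon_exponent k - Sidon_exponent j + Sidon_exponent l"
  have "\<bar>m\<bar> < 7 \<and> (m = 0 \<longleftrightarrow> i = k \<and> j = l \<or> i = j \<and> k = l)"
    using assms by (auto simp: m_def Sidon_exponent_def less_Suc_eq numeral_3_eq_3)
  moreover have "phase t i * cnj (phase t k) * cnj (phase t j * cnj (phase t l))
      = cis (2 * pi * real t * m / real 7)" for t
    by (simp add: phase_def cis_cnj cis_mult m_def add_divide_distrib diff_divide_distrib algebra_simps)
  ultimately show ?thesis
    using sum_cis_root_of_unity[of m 7] by simp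
qed

text \<open>
  The average of the rank one matrices of \<open>(p\<^sub>i \<omega>\<^sub>i) \<otimes> (q\<^sub>i \<omega>\<^sub>i\<^sup>-\<^sup>1)\<close> over the phases \<open>\<omega>\<close>.
\<close>

definition twirled :: "(nat \<Rightarrow> real) \<Rightarrow> (nat \<Rightarrow> real) \<Rightarrow> complex mat" where
  "twirled p q = mat 9 9 (\<lambda>(r, s). complex_of_real
     (if r = s then (p (r div 3) * q (r mod 3))\<^sup>2
      else if r \<in> {0, 4, 8} \<and> s \<in> {0, 4, 8}
        then p (r div 3) * q (r div 3) * (p (s div 3) * q (s div 3)) else 0))"

lemma dim_twirled [simp]: "dim_row (twirled p q) = 9" "dim_col (twirled p q) = 9"
  by (simp_all add: twirled_def)

lemma separable_twirled: "separable 3 3 (twirled p q)"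
proof -
  \<comment> \<open>The factor \<open>1 / sqrt 7\<close> turns the sum over seven phases into an
    average.\<close>
  define x where "x t = vec 3 (\<lambda>i. p i / sqrt 7 * phase t i)" for t
  define y where "y t = vec 3 (\<lambda>i. q i * cnj (phase t i))" for t
  define ps where "ps = map (\<lambda>t. (x t, y t)) [0..<7]"
  let ?f = "\<lambda>(x, y). rank_one (tensor_vec x y)"
  have ps: "set ps \<subseteq> carrier_vec 3 \<times> carrier_vec 3"
    by (auto simp: ps_def x_def y_def)
  have car: "?f u \<in> carrier_mat 9 9" if "u \<in> set ps" for u
    using that ps rank_one_tensor_carrier[of _ 3 _ 3] by auto
  have "twirled p q = foldr (+) (map ?f ps) (0\<^sub>m 9 9)"
  proof (rule eq_matI)
    fix r s
    assume "r < dim_row (foldr (+) (map ?f ps) (0\<^sub>m 9 9))"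
      "s < dim_col (foldr (+) (map ?f ps) (0\<^sub>m 9 9))"
    then have rs: "r < 9" "s < 9"
      using foldr_add_mat_carrier[of ps ?f, OF car] by auto
    define i k j l where ijkl: "i = r div 3" "k = r mod 3" "j = s div 3" "l = s mod 3"
    have lt: "i < 3" "k < 3" "j < 3" "l < 3"
      using rs by (auto simp: ijkl)
    have rs_eq: "r = 3 * i + k" "s = 3 * j + l"
      by (simp_all add: ijkl)
    have "foldr (+) (map ?f ps) (0\<^sub>m 9 9) $$ (r, s) = (\<Sum>u\<leftarrow>ps. ?f u $$ (r, s))"
      using car rs by (intro foldr_add_mat_index)
    also have "\<dots> = (\<Sum>t<7. rank_one (tensor_vec (x t) (y t)) $$ (r, s))"
      by (simp add: ps_def comp_def interv_sum_list_conv_sum_set_nat atLeast0LessThan)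
    also have "\<dots> = (\<Sum>t<7. (p i * q k * p j * q l / 7) *
        (phase t i * cnj (phase t k) * cnj (phase t j * cnj (phase t l))))"
    proof (rule sum.cong)
      fix t
      have "rank_one (tensor_vec (x t) (y t)) $$ (r, s) =
          x t $ i * y t $ k * cnj (x t $ j * y t $ l)"
        using rs by (subst rank_one_tensor_index[of _ 3 _ 3]) (auto simp: x_def y_def ijkl)
      also have "\<dots> = (p i * q k * p j * q l / (sqrt 7 * sqrt 7)) *
          (phase t i * cnj (phase t k) * cnj (phase t j * cnj (phase t l)))"
        using lt by (simp add: x_def y_def field_simps del: real_sqrt_mult_self)
      finally show "rank_one (tensor_vec (x t) (y t)) $$ (r, s) = (p i * q k * p j * q l / 7) *
          (phase t i * cnj (phase t k) * cnj (phase t j * cnj (phase t l)))"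
        by simp
    qed simp
    also have "\<dots> = p i * q k * p j * q l *
        (if i = k \<and> j = l \<or> i = j \<and> k = l then 1 else 0)"
      using lt by (subst sum_distrib_left[symmetric], subst sum_phase) auto
    also have "\<dots> = twirled p q $$ (r, s)"
    proof -
      have "r \<in> {0, 4, 8} \<longleftrightarrow> i = k" "s \<in> {0, 4, 8} \<longleftrightarrow> j = l"
        using rs[unfolded less_9_iff] by (auto simp: ijkl)
      moreover have "r = s \<longleftrightarrow> i = j \<and> k = l"
        using lt unfolding rs_eq by presburger
      ultimately show ?thesis
        using rs unfolding twirled_def
        by (auto simp: ijkl[symmetric] power2_eq_square mult_ac)
    qed
    finally show "twirled p q $$ (r, s) = foldr (+) (map ?f ps) (0\<^sub>m 9 9) $$ (r, s)"
      by simp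
  next
    show "dim_row (twirled p q) = dim_row (foldr (+) (map ?f ps) (0\<^sub>m 9 9))"
      "dim_col (twirled p q) = dim_col (foldr (+) (map ?f ps) (0\<^sub>m 9 9))"
      using foldr_add_mat_carrier[of ps ?f, OF car] by (auto simp: twirled_def)
  qed
  then show ?thesis
    using ps unfolding separable_def by auto
qed

section \<open>Separable decompositions and sufficiency\<close>

lemma separable_diagonal:
  fixes d :: "nat \<Rightarrow> real"
  assumes "\<And>r. r < m * n \<Longrightarrow> 0 \<le> d r"
  shows "separable m n (mat (m * n) (m * n) (\<lambda>(r, s). if r = s then complex_of_real (d r) else 0))"
proof -
  define ps where "ps = map (\<lambda>t. (complex_of_real (sqrt (d t)) \<cdot>\<^sub>v unit_vec m (t div n),
      unit_vec n (t mod n) :: complex vec)) [0..<m * n]"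
  let ?f = "\<lambda>(x, y). rank_one (tensor_vec x y)"
  let ?F = "foldr (+) (map ?f ps) (0\<^sub>m (m * n) (m * n))"
  have ps: "set ps \<subseteq> carrier_vec m \<times> carrier_vec n"
    by (auto simp: ps_def)
  have car: "?f u \<in> carrier_mat (m * n) (m * n)" if "u \<in> set ps" for u
    using that ps rank_one_tensor_carrier by auto
  have "mat (m * n) (m * n) (\<lambda>(r, s). if r = s then complex_of_real (d r) else 0) = ?F"
    (is "?D = _")
  proof (rule eq_matI)
    fix r s
    assume "r < dim_row ?F" "s < dim_col ?F"
    then have rs: "r < m * n" "s < m * n"
      using foldr_add_mat_carrier[of ps ?f, OF car] by auto
    have n: "0 < n" using rs by (cases n) auto
    have "?F $$ (r, s) = (\<Sum>u\<leftarrow>ps. ?f u $$ (r, s))"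
      using car rs by (intro foldr_add_mat_index)
    also have "\<dots> = (\<Sum>t<m * n. ?f (complex_of_real (sqrt (d t)) \<cdot>\<^sub>v unit_vec m (t div n),
        unit_vec n (t mod n)) $$ (r, s))"
      by (simp add: ps_def comp_def interv_sum_list_conv_sum_set_nat atLeast0LessThan)
    also have "\<dots> = (\<Sum>t<m * n. if t = r then (if r = s then complex_of_real (d r) else 0) else 0)"
    proof (rule sum.cong)
      fix t
      assume "t \<in> {..<m * n}"
      then have t: "t < m * n" by simp
      have eq: "u = v \<longleftrightarrow> u div n = v div n \<and> u mod n = v mod n" for u v :: nat
        by (metis div_mult_mod_eq)
      have dm: "u div n < m" "u mod n < n" if "u < m * n" for u
        using that n by (simp_all add: less_mult_imp_div_less)
      have "sqrt (d t) * sqrt (d t) = d t"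
        using assms[OF t] by simp
      then have "complex_of_real (sqrt (d t)) * complex_of_real (sqrt (d t)) = d t"
        by (metis of_real_mult)
      moreover have "d t = d r" if "t div n = r div n" "t mod n = r mod n"
        using that eq[of t r] by simp
      ultimately show "?f (complex_of_real (sqrt (d t)) \<cdot>\<^sub>v unit_vec m (t div n), unit_vec n (t mod n)) $$ (r, s)
        = (if t = r then (if r = s then complex_of_real (d r) else 0) else 0)"
        using rs t dm[OF t] dm[OF rs(1)] dm[OF rs(2)]
        by (auto simp: rank_one_tensor_index[of _ m _ n] eq[of t r] eq[of r s])
    qed simp
    also have "\<dots> = ?D $$ (r, s)"
      using rs by simp
    finally show "?D $$ (r, s) = ?F $$ (r, s)"
      by simp
  next
    show "dim_row ?D = dim_row ?F" "dim_col ?D = dim_col ?F"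
      using foldr_add_mat_carrier[of ps ?f, OF car] by auto
  qed
  then show ?thesis
    using ps unfolding separable_def by auto
qed

text \<open>The constant vectors contribute \<open>\<tau>\<^sup>2\<close> times
  \<open>A[1,1,1]\<close>. \<open>M i j\<close> lives on the coordinates \<open>i, j\<close>, with
  both diagonal products equal to \<open>w\<close> by \<open>hq\<close>. Each diagonal pair lies in
  two of the three blocks and each off-diagonal one in a single block, hence
  \<open>2 * w\<^sup>2\<close> but \<open>\<tau>\<^sup>2 + w\<^sup>2 = 1\<close>. The diagonal
  \<open>D\<close> supplies the slack in \<open>a\<close> and \<open>c\<close>.\<close>

lemma separable_A_mat_param:
  fixes \<tau> w h q \<delta> \<epsilon> :: real
  assumes hq: "h * q = w" and one: "\<tau>\<^sup>2 + w\<^sup>2 = 1" and nonneg: "0 \<le> \<delta>" "0 \<le> \<epsilon>"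
  shows "separable 3 3 (A_mat (\<tau>\<^sup>2 + 2 * w\<^sup>2 + \<delta>) (\<tau>\<^sup>2 + h\<^sup>2) (\<tau>\<^sup>2 + (w * q)\<^sup>2 + \<epsilon>))"
    (is "separable 3 3 ?A")
proof -
  define M where "M i j = twirled (\<lambda>k. if k = i then w else if k = j then h else 0)
    (\<lambda>k. if k = i then 1 else if k = j then q else 0)" for i j :: nat
  define d where "d r = [\<delta>, \<epsilon>, 0, 0, \<delta>, \<epsilon>, \<epsilon>, 0, \<delta>] ! r" for r :: nat
  define D where "D = mat 9 9 (\<lambda>(r, s). if r = s then complex_of_real (d r) else 0)"
  have "0 \<le> d r" if "r < 9" for r
    using that nonneg by (auto simp: less_9_iff d_def)
  then have "separable 3 3 D"
    using separable_diagonal[of 3 3 d] by (simp add: D_def)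
  moreover have "separable 3 3 (twirled (\<lambda>_. \<tau>) (\<lambda>_. 1))"
    by (rule separable_twirled)
  moreover have D: "dim_row D = 9" "dim_col D = 9"
    by (simp_all add: D_def)
  moreover have "?A = twirled (\<lambda>_. \<tau>) (\<lambda>_. 1) + (M 0 1 + (M 1 2 + (M 2 0 + D)))" (is "_ = ?R")
  proof (rule eq_matI)
    fix r s
    assume "r < dim_row ?R" "s < dim_col ?R"
    then have rs: "r < 9" "s < 9"
      by (simp_all add: D)
    consider "r = s" | "r \<noteq> s" "r \<in> {0, 4, 8}" "s \<in> {0, 4, 8}"
      | "r \<noteq> s" "\<not> (r \<in> {0, 4, 8} \<and> s \<in> {0, 4, 8})"
      by blast
    then show "?A $$ (r, s) = ?R $$ (r, s)"
    proof cases
      case 1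
      then show ?thesis
        using rs(1)[unfolded less_9_iff] hq
        by (auto simp: A_mat_def M_def D_def d_def twirled_def)
    next
      case 2
      then have "?R $$ (r, s) = complex_of_real (\<tau>\<^sup>2 + w\<^sup>2)"
        by (auto simp: M_def D_def twirled_def power2_eq_square simp flip: hq)
      also have "\<dots> = ?A $$ (r, s)"
        using 2 rs by (simp add: one A_mat_def)
      finally show ?thesis
        by simp
    next
      case 3
      then have "twirled p' q' $$ (r, s) = 0" for p' q'
        using rs by (simp only: twirled_def index_mat prod.case if_False simp_thms of_real_0)
      moreover have "?A $$ (r, s) = 0" "D $$ (r, s) = 0"
        using 3 rs
        by (simp_all only: A_mat_def D_def index_mat prod.case if_False simp_thms)
      ultimately show ?thesis
        using rs D by (simp add: M_def)
    qed
  qed (simp_all add: A_mat_def D)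
  ultimately show ?thesis
    by (auto simp: M_def intro!: separable_add separable_twirled)
qed

lemma separable_A_mat_of_hyperbola:
  fixes t \<beta> \<gamma> :: real
  assumes "0 \<le> t" "t \<le> 1" "0 \<le> \<beta>" "0 \<le> \<gamma>" "(1 - t)\<^sup>2 \<le> \<beta> * \<gamma>" "2 - t \<le> a"
  shows "separable 3 3 (A_mat a (t + \<beta>) (t + \<gamma>))"
proof -
  define w where "w = sqrt (1 - t)"
  \<comment> \<open>This solves \<open>h * q = w\<close> with \<open>h = sqrt \<beta>\<close>. If
    \<beta> = 0, division yields \<open>q = 0\<close>, which is consistent because the hyperbola
    condition then forces \<open>w = 0\<close>.\<close>
  define q where "q = w / sqrt \<beta>"
  have w: "w\<^sup>2 = 1 - t"
    using assms by (simp add: w_def)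
  have "w = 0" if "\<beta> = 0"
    using assms that by (simp add: w_def)
  then have "sqrt \<beta> * q = w"
    by (auto simp: q_def)
  moreover have "(w * q)\<^sup>2 = (1 - t)\<^sup>2 / \<beta>"
    using assms(3) by (simp add: q_def power_mult_distrib power_divide w) (simp add: power2_eq_square)
  moreover have "(1 - t)\<^sup>2 / \<beta> \<le> \<gamma>"
    using assms by (cases "\<beta> = 0") (simp_all add: field_simps)
  ultimately have "separable 3 3 (A_mat ((sqrt t)\<^sup>2 + 2 * w\<^sup>2 + (a - (2 - t)))
      ((sqrt t)\<^sup>2 + (sqrt \<beta>)\<^sup>2) ((sqrt t)\<^sup>2 + (w * q)\<^sup>2 + (\<gamma> - (w * q)\<^sup>2)))"
    using assms w by (intro separable_A_mat_param) auto
  moreover have "(sqrt t)\<^sup>2 + 2 * w\<^sup>2 + (a - (2 - t)) = a" "(sqrt t)\<^sup>2 + (sqrt \<beta>)\<^sup>2 = t + \<beta>"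
    "(sqrt t)\<^sup>2 + (w * q)\<^sup>2 + (\<gamma> - (w * q)\<^sup>2) = t + \<gamma>"
    using assms w by simp_all
  ultimately show ?thesis
    by (simp only:)
qed

lemma separable_A_mat_sufficient:
  assumes "1 \<le> a" "1 \<le> b * c" "0 \<le> a + b - 2" "(1 - a)\<^sup>2 \<le> (b + a - 2) * (c + a - 2)"
    and bc: "0 \<le> b" "0 \<le> c"
  shows "separable 3 3 (A_mat a b c)"
proof (cases "2 \<le> a")
  case True
  then show ?thesis
    \<comment> \<open>With \<open>t = 0\<close> the hyperbola condition is
      \<open>1 \<le> b * c\<close>.\<close>
    using separable_A_mat_of_hyperbola[of 0 b c a] assms by simp
next
  case False
  \<comment> \<open>The product inequality gives this sign unless \<open>a + b = 2\<close>; then it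
    forces \<open>a = b = 1\<close>, and \<open>1 \<le> b * c\<close> takes over.\<close>
  have "0 \<le> c + a - 2"
  proof (cases "a + b - 2 = 0")
    case True
    then have "(1 - a)\<^sup>2 \<le> 0"
      using assms(4) by (simp add: algebra_simps)
    then have "a = 1" by simp
    with True have "b = 1" by simp
    then show ?thesis
      using \<open>a = 1\<close> assms(2) by simp
  next
    case False
    then have "0 < b + a - 2"
      using assms(3) by simp
    moreover have "0 \<le> (b + a - 2) * (c + a - 2)"
      using assms(4) by (rule order_trans[rotated]) simp
    ultimately show ?thesis
      by (simp add: zero_le_mult_iff)
  qed
  then show ?thesis
    using separable_A_mat_of_hyperbola[of "2 - a" "b + a - 2" "c + a - 2" a] assms False
    by (simp add: power2_commute)
qed

section \<open>Quadratic forms and the PPT criterion\<close>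

lemma complex_quadform_expand:
  fixes A :: "complex mat"
  assumes "A \<in> carrier_mat n n" "v \<in> carrier_vec n"
  shows "(A *\<^sub>v v) \<bullet>c v = (\<Sum>r<n. \<Sum>s<n. A $$ (r, s) * v $ s * cnj (v $ r))"
  using assms
  by (auto simp: scalar_prod_def atLeast0LessThan sum_distrib_right intro!: sum.cong)

lemma A_mat_quadform:
  assumes "v \<in> carrier_vec 9"
  shows "(A_mat a b c *\<^sub>v v) \<bullet>c v = complex_of_real (
    (a - 1) * ((cmod (v $ 0))\<^sup>2 + (cmod (v $ 4))\<^sup>2 + (cmod (v $ 8))\<^sup>2)
    + (cmod (v $ 0 + v $ 4 + v $ 8))\<^sup>2
    + b * ((cmod (v $ 2))\<^sup>2 + (cmod (v $ 3))\<^sup>2 + (cmod (v $ 7))\<^sup>2)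
    + c * ((cmod (v $ 1))\<^sup>2 + (cmod (v $ 5))\<^sup>2 + (cmod (v $ 6))\<^sup>2))"
proof -
  have A: "A_mat a b c \<in> carrier_mat 9 9"
    by (simp add: A_mat_def)
  have nine: "{..<9::nat} = {0, 1, 2, 3, 4, 5, 6, 7, 8}"
    by auto
  show ?thesis
    unfolding complex_quadform_expand[OF A assms] nine cmod_power2
    by (simp add: A_mat_def complex_eq_iff cmod_power2 power2_eq_square algebra_simps)
qed

text \<open>Partial transposition moves the ones to the index pairs (1,3), (5,7) and (6,2). The form
  splits into three scalars \<open>a\<close> and three 2 by 2 blocks with diagonal
  \<open>c, b\<close> and off-diagonal 1.\<close>

lemma partial_transpose_A_mat_quadform:
  assumes "v \<in> carrier_vec 9"
  shows "(partial_transpose 3 3 (A_mat a b c) *\<^sub>v v) \<bullet>c v = complex_of_real (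
    a * ((cmod (v $ 0))\<^sup>2 + (cmod (v $ 4))\<^sup>2 + (cmod (v $ 8))\<^sup>2)
    + (c * (cmod (v $ 1))\<^sup>2 + b * (cmod (v $ 3))\<^sup>2 + 2 * Re (v $ 1 * cnj (v $ 3)))
    + (c * (cmod (v $ 5))\<^sup>2 + b * (cmod (v $ 7))\<^sup>2 + 2 * Re (v $ 5 * cnj (v $ 7)))
    + (c * (cmod (v $ 6))\<^sup>2 + b * (cmod (v $ 2))\<^sup>2 + 2 * Re (v $ 6 * cnj (v $ 2))))"
proof -
  have A: "partial_transpose 3 3 (A_mat a b c) \<in> carrier_mat 9 9"
    by (simp add: partial_transpose_def)
  have nine: "{..<9::nat} = {0, 1, 2, 3, 4, 5, 6, 7, 8}"
    by auto
  show ?thesis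
    unfolding complex_quadform_expand[OF A assms] nine cmod_power2
    by (simp add: A_mat_def partial_transpose_def mat_block_def complex_eq_iff cmod_power2
        power2_eq_square algebra_simps)
qed

lemma positive_semidefinite_A_mat_iff:
  assumes "0 \<le> b" "0 \<le> c"
  shows "positive_semidefinite (A_mat a b c) \<longleftrightarrow> 1 \<le> a"
proof
  assume psd: "positive_semidefinite (A_mat a b c)"
  \<comment> \<open>This vector kills the square of \<open>v $ 0 + v $ 4 + v $ 8\<close> and leaves
    \<open>2 * (a - 1)\<close>.\<close>
  define v :: "complex vec" where "v = vec 9 (\<lambda>r. if r = 0 then 1 else if r = 4 then - 1 else 0)"
  have "v \<in> carrier_vec 9" by (simp add: v_def)
  moreover from this have "0 \<le> (A_mat a b c *\<^sub>v v) \<bullet>c v"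
    using psd by (auto simp: positive_semidefinite_def A_mat_def)
  ultimately show "1 \<le> a"
    by (simp add: A_mat_quadform) (simp add: v_def less_eq_complex_def)
next
  assume "1 \<le> a"
  then have "0 \<le> (A_mat a b c *\<^sub>v v) \<bullet>c v" if "v \<in> carrier_vec 9" for v
    using assms that by (simp add: A_mat_quadform less_eq_complex_def)
  then show "positive_semidefinite (A_mat a b c)"
    by (auto simp: positive_semidefinite_def A_mat_def)
qed

text \<open>The first two terms are at least \<open>2 * sqrt (b * c) * cmod u * cmod v\<close> by
  the arithmetic-geometric mean inequality, which dominates the cross term.\<close>

lemma binary_hermitian_form_nonneg:
  fixes b c :: real and u v :: complex
  assumes "0 \<le> b" "0 \<le> c" "1 \<le> b * c"
  shows "0 \<le> c * (cmod u)\<^sup>2 + b * (cmod v)\<^sup>2 + 2 * Re (u * cnj v)"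
proof -
  have "1 \<le> sqrt c * sqrt b"
    using assms by (simp flip: real_sqrt_mult add: mult.commute)
  then have "cmod u * cmod v \<le> sqrt c * sqrt b * (cmod u * cmod v)"
    using mult_right_mono[of 1 "sqrt c * sqrt b" "cmod u * cmod v"] by simp
  moreover have "0 \<le> (sqrt c * cmod u - sqrt b * cmod v)\<^sup>2"
    by simp
  moreover have "(sqrt c * cmod u - sqrt b * cmod v)\<^sup>2 =
      c * (cmod u)\<^sup>2 + b * (cmod v)\<^sup>2 - 2 * (sqrt c * sqrt b * (cmod u * cmod v))"
    using assms by (simp add: power2_diff power_mult_distrib)
  moreover have "- (cmod u * cmod v) \<le> Re (u * cnj v)"
    using abs_Re_le_cmod[of "u * cnj v"] by (simp add: norm_mult)
  ultimately show ?thesis by linarith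
qed

lemma complex_of_real_nonneg_iff: "0 \<le> complex_of_real x \<longleftrightarrow> 0 \<le> x"
  by (simp add: less_eq_complex_def)

lemma positive_semidefinite_partial_transpose_A_mat_iff:
  assumes "0 \<le> a" "0 \<le> b" "0 \<le> c"
  shows "positive_semidefinite (partial_transpose 3 3 (A_mat a b c)) \<longleftrightarrow> 1 \<le> b * c"
proof
  assume psd: "positive_semidefinite (partial_transpose 3 3 (A_mat a b c))"
  have "0 \<le> b * s\<^sup>2 - 2 * 1 * s + c" for s :: real
  proof -
    define v :: "complex vec"
      where "v = vec 9 (\<lambda>r. if r = 1 then 1 else if r = 3 then - complex_of_real s else 0)"
    have "v \<in> carrier_vec 9" by (simp add: v_def)
    moreover from this have "0 \<le> (partial_transpose 3 3 (A_mat a b c) *\<^sub>v v) \<bullet>c v"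
      using psd by (auto simp: positive_semidefinite_def partial_transpose_def)
    ultimately show ?thesis
      by (simp add: partial_transpose_A_mat_quadform) (simp add: v_def less_eq_complex_def algebra_simps)
  qed
  from quadratic_nonneg_coeffs(2)[OF this] show "1 \<le> b * c"
    by simp
next
  assume "1 \<le> b * c"
  then have "0 \<le> (partial_transpose 3 3 (A_mat a b c) *\<^sub>v v) \<bullet>c v" if "v \<in> carrier_vec 9" for v
    unfolding partial_transpose_A_mat_quadform[OF that] complex_of_real_nonneg_iff
    \<comment> \<open>The patterns keep each 2 by 2 block intact, since its cross term alone may be
      negative.\<close>
    using assms by (intro add_nonneg_nonneg[of "a * _ + _ + _"] add_nonneg_nonneg[of "a * _ + _"]
        add_nonneg_nonneg[of "a * _"] binary_hermitian_form_nonneg) simp_all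
  then show "positive_semidefinite (partial_transpose 3 3 (A_mat a b c))"
    by (auto simp: positive_semidefinite_def partial_transpose_def)
qed

theorem theorem3p1:
  fixes a b c :: real
  assumes "0 \<le> a" and "0 \<le> b" and "0 \<le> c"
  shows "(is_ppt 3 3 (A_mat a b c) \<longleftrightarrow> 1 \<le> a \<and> 1 \<le> b * c) \<and>
    (separable 3 3 (A_mat a b c) \<longleftrightarrow>
       1 \<le> a \<and> 1 \<le> b * c \<and> 0 \<le> a + b - 2 \<and>
       (1 - a)\<^sup>2 \<le> (b + a - 2) * (c + a - 2))"
proof -
  have "A_mat a b c \<in> carrier_mat (3 * 3) (3 * 3)"
    by (simp add: A_mat_def)
  then show ?thesis
    using assms separable_A_mat_necessary[of a b c] separable_A_mat_sufficient[of a b c]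
    by (auto simp: is_ppt_def positive_semidefinite_A_mat_iff
        positive_semidefinite_partial_transpose_A_mat_iff)
qed

end
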